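(* Let $k \ge 1$ be an integer, let the scalar $\gamma$ be the coefficient of the regularization term, and for each class $y \in \{0,1,\dots,C_k\}$ let $\pi_y$ be a scalar, which can be arbitrarily configured. For each phase $t \in \{1,\dots,k\}$ and each class $y \in \{0,\dots,C_k\}$, let $X_t^{(y)}$ be the matrix whose rows are the feature row vectors of the samples of class $y$ at phase $t$, and let $Y_t^{(y)}$ be the corresponding matrix of one-hot labels (all of its rows equal $\operatorname{onehot}(y)$). Let $X_{1:k}^{(y)}$ and $Y_{1:k}^{(y)}$ be obtained by vertically stacking $X_1^{(y)},\dots,X_k^{(y)}$ and $Y_1^{(y)},\dots,Y_k^{(y)}$, respectively. Define the weighted loss of a classifier weight matrix $W_k$ at phase $k$ by $$\mathcal{L}_{\mathrm{we}}(W_k) = \sum_{y=0}^{C_k} \pi_y \left\lVert X_{1:k}^{(y)} W_k - Y_{1:k}^{(y)} \right\rVert_{\mathrm{F}}^2 + \gamma \lVert W_k \rVert_{\mathrm{F}}^2 .$$ Then the global optimal weight of the weighted classifier at phase $k$ is $$\bar{W}_k = \operatorname*{argmin}_{W_k} \mathcal{L}_{\mathrm{we}}(W_k) = \left( \sum_{y=0}^{C_k} \pi_y A_{1:k}^{(y)} + \gamma I \right)^{-1} \left( \sum_{y=0}^{C_k} \pi_y C_{1:k}^{(y)} \right),$$ where $$A_{1:k}^{(y)} = \sum_{t=1}^{k} X_t^{(y)\top} X_t^{(y)} = A_{1:k-1}^{(y)} + X_k^{(y)\top} X_k^{(y)}, \qquad C_{1:k}^{(y)} = \sum_{t=1}^{k}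 X_t^{(y)\top} Y_t^{(y)} = C_{1:k-1}^{(y)} + X_k^{(y)\top} Y_k^{(y)}$$ can be obtained iteratively.
   Context: Setting: labelled training data arrive sequentially in phases $t = 1, 2, \dots$. Each sample is represented by a feature row vector $x$ of length $f$ and an integer class label $y$. $C_k$ is the maximum label value occurring in phases $1$ to $k$; the classes at phase $k$ are indexed by $0, 1, \dots, C_k$. If class $y$ has no samples at phase $t$, the matrices $X_t^{(y)}$ and $Y_t^{(y)}$ have no rows and contribute zero to all sums; sums over an empty range of phases are zero, so $A_{1:0}^{(y)} = 0$ and $C_{1:0}^{(y)} = 0$. $\operatorname{onehot}(y)$ is the row vector of length $C_k+1$ whose entry indexed by $y$ is $1$ and whose other entries are $0$ (labels from earlier phases are written with this same length). Accordingly $W_k$ is a real $f \times (C_k+1)$ matrix. $\lVert \cdot \rVert_{\mathrm{F}}$ is the Frobenius norm and $I$ is the $f \times f$ identity matrix. The scalar $\pi_y$ is the re-weighting factor of class $y$ in the loss. The matrix $C_{1:k}^{(y)}$ is unrelated to the integer $C_k$.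
   Formalization: The formula is proved to be the unique minimiser, with the inverse existing, when γ > 0 and all π_y ≥ 0; for other real γ, π_y it is proved provided a global minimiser and the inverse exist (with x = 0, γ = −1 there is no minimiser). Some phase is assumed to have data. *)

theory Defs
  imports "Jordan_Normal_Form.Gauss_Jordan_Elimination"
begin

text \<open>A sample is a feature vector together with its class label; \<open>D t\<close> is the list of
  samples arriving at phase \<open>t\<close>.  Throughout, \<open>f\<close> is the feature length and \<open>m\<close> the
  length of the one-hot rows.\<close>

type_synonym sample = "real vec \<times> nat"

definition max_label :: "(nat \<Rightarrow> sample list) \<Rightarrow> nat \<Rightarrow> nat" where
  "max_label D k = Max (\<Union>t\<in>{1..k}. snd ` set (D t))"

definition class_samples :: "(nat \<Rightarrow> sample list) \<Rightarrow> nat \<Rightarrow> nat \<Rightarrow> sample list" where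
  "class_samples D t y = filter (\<lambda>s. snd s = y) (D t)"

definition feature_mat :: "nat \<Rightarrow> (nat \<Rightarrow> sample list) \<Rightarrow> nat \<Rightarrow> nat \<Rightarrow> real mat" where
  "feature_mat f D t y = mat_of_rows f (map fst (class_samples D t y))"

definition label_mat :: "nat \<Rightarrow> (nat \<Rightarrow> sample list) \<Rightarrow> nat \<Rightarrow> nat \<Rightarrow> real mat" where
  "label_mat m D t y = mat_of_rows m (map (\<lambda>s. unit_vec m (snd s)) (class_samples D t y))"

definition vstack :: "nat \<Rightarrow> real mat list \<Rightarrow> real mat" where
  "vstack n Ms = mat_of_rows n (concat (map rows Ms))"

definition features_upto :: "nat \<Rightarrow> (nat \<Rightarrow> sample list) \<Rightarrow> nat \<Rightarrow> nat \<Rightarrow> real mat" where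
  "features_upto f D k y = vstack f (map (\<lambda>t. feature_mat f D t y) [1..<Suc k])"

definition labels_upto :: "nat \<Rightarrow> (nat \<Rightarrow> sample list) \<Rightarrow> nat \<Rightarrow> nat \<Rightarrow> real mat" where
  "labels_upto m D k y = vstack m (map (\<lambda>t. label_mat m D t y) [1..<Suc k])"

text \<open>The type \<^typ>\<open>real mat\<close> has no zero element of its own, so sums of matrices
  are taken in the abelian group of matrices of a given shape.\<close>

abbreviation mat_finsum :: "nat \<Rightarrow> nat \<Rightarrow> ('i \<Rightarrow> real mat) \<Rightarrow> 'i set \<Rightarrow> real mat" where
  "mat_finsum nr nc \<equiv> finsum (module_mat TYPE(real) nr nc)"

definition autocorrelation :: "nat \<Rightarrow> (nat \<Rightarrow> sample list) \<Rightarrow> nat \<Rightarrow> nat \<Rightarrow> real mat" where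
  "autocorrelation f D k y =
     mat_finsum f f (\<lambda>t. transpose_mat (feature_mat f D t y) * feature_mat f D t y) {1..k}"

definition crosscorrelation ::
    "nat \<Rightarrow> nat \<Rightarrow> (nat \<Rightarrow> sample list) \<Rightarrow> nat \<Rightarrow> nat \<Rightarrow> real mat" where
  "crosscorrelation f m D k y =
     mat_finsum f m (\<lambda>t. transpose_mat (feature_mat f D t y) * label_mat m D t y) {1..k}"

definition frobenius_norm :: "real mat \<Rightarrow> real" where
  "frobenius_norm A = sqrt (\<Sum>i<dim_row A. \<Sum>j<dim_col A. (A $$ (i, j))\<^sup>2)"

definition weighted_loss ::
    "nat \<Rightarrow> (nat \<Rightarrow> sample list) \<Rightarrow> nat \<Rightarrow> (nat \<Rightarrow> real) \<Rightarrow> real \<Rightarrow> real mat \<Rightarrow> real" where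
  "weighted_loss f D k w \<gamma> W =
     (\<Sum>y\<le>max_label D k. w y *
        (frobenius_norm (features_upto f D k y * W
           - labels_upto (max_label D k + 1) D k y))\<^sup>2)
     + \<gamma> * (frobenius_norm W)\<^sup>2"

end

theory Submission
  imports Defs "Jordan_Normal_Form.Determinant"
begin

text \<open>With \<open>M\<close> the regularised weighted Gram matrix, \<open>B\<close> the weighted cross-correlation and
  \<open>\<langle>\<cdot>, \<cdot>\<rangle>\<close> the Frobenius inner product, the loss is the quadratic
  \<open>L (W + H) = L W + 2 \<langle>H, M W - B\<rangle> + \<langle>H, M H\<rangle>\<close>.  At any minimiser the linear term vanishes for
  \<open>H\<close> in the direction \<open>M W - B\<close>, which forces \<open>M W = B\<close>.  If \<open>\<gamma> > 0\<close> and all weights are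
  nonnegative, the quadratic term is positive definite; hence \<open>M\<close> is injective and the solution of
  \<open>M W = B\<close> is a strict global minimiser.\<close>

section \<open>The Frobenius inner product\<close>

text \<open>The index ranges are read off \<open>A\<close> alone, so this is the usual inner product
  only when \<open>B\<close> has the shape of \<open>A\<close>; \<open>carrier_mat\<close>
  assumptions below secure that where both arguments matter.\<close>

definition frobenius_inner :: "real mat \<Rightarrow> real mat \<Rightarrow> real" where
  "frobenius_inner A B = (\<Sum>i<dim_row A. \<Sum>j<dim_col A. A $$ (i, j) * B $$ (i, j))"

lemma frobenius_norm_sq: "(frobenius_norm A)\<^sup>2 = frobenius_inner A A"
  by (simp add: frobenius_norm_def frobenius_inner_def sum_nonneg power2_eq_square)

lemma frobenius_inner_self_nonneg: "0 \<le> frobenius_inner A A"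
  by (simp add: frobenius_inner_def sum_nonneg)

lemma frobenius_inner_self_eq_0:
  assumes A: "A \<in> carrier_mat n m" and 0: "frobenius_inner A A = 0"
  shows "A = 0\<^sub>m n m"
proof (rule eq_matI)
  fix i j assume ij: "i < dim_row (0\<^sub>m n m :: real mat)" "j < dim_col (0\<^sub>m n m :: real mat)"
  have "\<forall>i\<in>{..<n}. (\<Sum>j<m. A $$ (i, j) * A $$ (i, j)) = 0"
    using 0 A by (subst (asm) frobenius_inner_def, subst (asm) sum_nonneg_eq_0_iff)
      (auto intro!: sum_nonneg)
  then have "(\<Sum>j<m. A $$ (i, j) * A $$ (i, j)) = 0" using ij by auto
  then show "A $$ (i, j) = 0\<^sub>m n m $$ (i, j)"
    using ij by (subst (asm) sum_nonneg_eq_0_iff) auto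
qed (use A in auto)

lemma frobenius_inner_self_pos:
  assumes "A \<in> carrier_mat n m" "A \<noteq> 0\<^sub>m n m"
  shows "0 < frobenius_inner A A"
  using frobenius_inner_self_eq_0[OF assms(1)] assms(2) frobenius_inner_self_nonneg[of A]
  by fastforce

lemma frobenius_inner_add_right:
  assumes "A \<in> carrier_mat n m" "B \<in> carrier_mat n m" "C \<in> carrier_mat n m"
  shows "frobenius_inner A (B + C) = frobenius_inner A B + frobenius_inner A C"
  using assms by (simp add: frobenius_inner_def distrib_left sum.distrib)

lemma frobenius_inner_diff_right:
  assumes "A \<in> carrier_mat n m" "B \<in> carrier_mat n m" "C \<in> carrier_mat n m"
  shows "frobenius_inner A (B - C) = frobenius_inner A B - frobenius_inner A C"
  using assms by (simp add: frobenius_inner_def right_diff_distrib sum_subtractf)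

lemma frobenius_inner_smult_right:
  assumes "A \<in> carrier_mat n m" "B \<in> carrier_mat n m"
  shows "frobenius_inner A (c \<cdot>\<^sub>m B) = c * frobenius_inner A B"
  using assms by (simp add: frobenius_inner_def sum_distrib_left mult.left_commute)

lemma frobenius_inner_smult_left:
  assumes "A \<in> carrier_mat n m"
  shows "frobenius_inner (c \<cdot>\<^sub>m A) B = c * frobenius_inner A B"
  using assms by (simp add: frobenius_inner_def sum_distrib_left mult.assoc)

lemma frobenius_inner_zero_right:
  assumes "A \<in> carrier_mat n m"
  shows "frobenius_inner A (0\<^sub>m n m) = 0"
  using assms by (simp add: frobenius_inner_def)

lemma frobenius_inner_add_self:
  assumes "A \<in> carrier_mat n m" "B \<in> carrier_mat n m"
  shows "frobenius_inner (A + B) (A + B) =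
    frobenius_inner A A + 2 * frobenius_inner B A + frobenius_inner B B"
  using assms by (simp add: frobenius_inner_def distrib_left distrib_right sum.distrib sum_distrib_left
      mult.commute)

text \<open>Left multiplication by \<open>transpose_mat A\<close> is the adjoint of left
  multiplication by \<open>A\<close>: both sides are one triple sum, taken in the order
  \<open>i\<close>, \<open>j\<close>, \<open>l\<close> on the left and \<open>l\<close>,
  \<open>j\<close>, \<open>i\<close> on the right. This is how Gram matrices arise from squared
  residuals.\<close>

lemma frobenius_inner_mult_left:
  assumes A: "A \<in> carrier_mat n p" and H: "H \<in> carrier_mat p m" and Z: "Z \<in> carrier_mat n m"
  shows "frobenius_inner (A * H) Z = frobenius_inner H (transpose_mat A * Z)"
proof -
  have "frobenius_inner (A * H) Z
      = (\<Sum>i<n. \<Sum>j<m. \<Sum>l<p. A $$ (i, l) * H $$ (l, j) * Z $$ (i, j))"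
    using A H by (simp add: frobenius_inner_def scalar_prod_def sum_distrib_right
        lessThan_atLeast0)
  also have "\<dots> = (\<Sum>i<n. \<Sum>l<p. \<Sum>j<m. A $$ (i, l) * H $$ (l, j) * Z $$ (i, j))"
    by (intro sum.cong refl sum.swap)
  also have "\<dots> = (\<Sum>l<p. \<Sum>i<n. \<Sum>j<m. A $$ (i, l) * H $$ (l, j) * Z $$ (i, j))"
    by (rule sum.swap)
  also have "\<dots> = (\<Sum>l<p. \<Sum>j<m. \<Sum>i<n. A $$ (i, l) * H $$ (l, j) * Z $$ (i, j))"
    by (intro sum.cong refl sum.swap)
  also have "\<dots> = frobenius_inner H (transpose_mat A * Z)"
    using A H Z by (simp add: frobenius_inner_def scalar_prod_def sum_distrib_left
        lessThan_atLeast0 ac_simps)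
  finally show ?thesis .
qed

section \<open>Finite sums of matrices of a fixed shape\<close>

lemma mat_finsum_closed:
  assumes "\<And>i. i \<in> I \<Longrightarrow> F i \<in> carrier_mat n m"
  shows "mat_finsum n m F I \<in> carrier_mat n m"
proof -
  interpret abelian_group "module_mat TYPE(real) n m" by (rule abelian_group_mat)
  show ?thesis using finsum_closed[of F I] assms by (auto simp: module_mat_simps)
qed

lemma mat_finsum_empty: "mat_finsum n m F {} = 0\<^sub>m n m"
proof -
  interpret abelian_group "module_mat TYPE(real) n m" by (rule abelian_group_mat)
  show ?thesis using finsum_empty[of F] by (simp add: module_mat_simps)
qed

lemma mat_finsum_insert:
  assumes "finite I" "a \<notin> I" "\<And>i. i \<in> insert a I \<Longrightarrow> F i \<in> carrier_mat n m"
  shows "mat_finsum n m F (insert a I) = F a + mat_finsum n m F I"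
proof -
  interpret abelian_group "module_mat TYPE(real) n m" by (rule abelian_group_mat)
  show ?thesis using finsum_insert[of I a F] assms by (auto simp: module_mat_simps)
qed

lemma frobenius_inner_mat_finsum:
  assumes "finite I" and "H \<in> carrier_mat n m" and "\<And>i. i \<in> I \<Longrightarrow> F i \<in> carrier_mat n m"
  shows "frobenius_inner H (mat_finsum n m F I) = (\<Sum>i\<in>I. frobenius_inner H (F i))"
  using assms(1,3)
proof (induction I)
  case empty
  then show ?case by (simp add: mat_finsum_empty frobenius_inner_zero_right[OF assms(2)])
next
  case (insert a I)
  have "mat_finsum n m F (insert a I) = F a + mat_finsum n m F I"
    using insert by (intro mat_finsum_insert) auto
  moreover have "mat_finsum n m F I \<in> carrier_mat n m"
    using insert by (intro mat_finsum_closed) auto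
  ultimately show ?case using insert by (simp add: frobenius_inner_add_right[OF assms(2)])
qed

text \<open>Distributing \<open>W\<close> over the sum at matrix level would involve two matrix
  groups, of shapes \<open>n\<close> by \<open>p\<close> and \<open>n\<close> by \<open>m\<close>.
  Pairing with \<open>H\<close> inside the induction passes directly to a sum of reals.\<close>

lemma frobenius_inner_mat_finsum_mult:
  assumes "finite I" and H: "H \<in> carrier_mat n m" and W: "W \<in> carrier_mat p m"
    and "\<And>i. i \<in> I \<Longrightarrow> F i \<in> carrier_mat n p"
  shows "frobenius_inner H (mat_finsum n p F I * W) = (\<Sum>i\<in>I. frobenius_inner H (F i * W))"
  using assms(1,4)
proof (induction I)
  case empty
  then show ?case using W by (simp add: mat_finsum_empty frobenius_inner_zero_right[OF H])
next
  case (insert a I)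
  have F: "F a \<in> carrier_mat n p" "mat_finsum n p F I \<in> carrier_mat n p"
    using insert.prems by (auto intro!: mat_finsum_closed)
  then have "(F a + mat_finsum n p F I) * W = F a * W + mat_finsum n p F I * W"
    using W by (rule add_mult_distrib_mat)
  moreover have "F a * W \<in> carrier_mat n m" "mat_finsum n p F I * W \<in> carrier_mat n m"
    using F W by auto
  moreover have "mat_finsum n p F (insert a I) = F a + mat_finsum n p F I"
    using insert by (intro mat_finsum_insert) auto
  ultimately show ?case using insert by (simp add: frobenius_inner_add_right[OF H])
qed

section \<open>Expansion of a squared residual\<close>

lemma add_diff_mat_commute:
  fixes A B C :: "'a :: ab_group_add mat"
  assumes "A \<in> carrier_mat n m" "B \<in> carrier_mat n m" "C \<in> carrier_mat n m"
  shows "A + B - C = (A - C) + B"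
  using assms by (intro eq_matI) auto

lemma diff_add_mat_cancel:
  fixes A B :: "'a :: ab_group_add mat"
  assumes "A \<in> carrier_mat n m" "B \<in> carrier_mat n m"
  shows "(A - B) + B = A"
  using assms by (intro eq_matI) auto

text \<open>Perturbing \<open>W\<close> by \<open>H\<close> perturbs the residual by
  \<open>X * H\<close>. The square of the sum is expanded, and the adjoint law moves
  \<open>X\<close> away from \<open>H\<close> in the cross term and in the quadratic term.\<close>

lemma frobenius_norm_residual_add:
  assumes X: "X \<in> carrier_mat n f" and Y: "Y \<in> carrier_mat n m"
    and W: "W \<in> carrier_mat f m" and H: "H \<in> carrier_mat f m"
  shows "(frobenius_norm (X * (W + H) - Y))\<^sup>2 = (frobenius_norm (X * W - Y))\<^sup>2
    + 2 * (frobenius_inner H (transpose_mat X * X * W) - frobenius_inner H (transpose_mat X * Y))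
    + frobenius_inner H (transpose_mat X * X * H)"
proof -
  have XT: "transpose_mat X \<in> carrier_mat f n" using X by simp
  have XW: "X * W \<in> carrier_mat n m" and XH: "X * H \<in> carrier_mat n m" using X W H by auto
  \<comment> \<open>A difference of matrices takes its dimensions from the subtrahend, so the shape
    of \<open>Y\<close> suffices.\<close>
  have R: "X * W - Y \<in> carrier_mat n m" using Y by auto
  have eq: "X * (W + H) - Y = (X * W - Y) + X * H"
    unfolding mult_add_distrib_mat[OF X W H] by (rule add_diff_mat_commute[OF XW XH Y])
  have "frobenius_inner (X * H) (X * W - Y) = frobenius_inner H (transpose_mat X * (X * W - Y))"
    by (rule frobenius_inner_mult_left[OF X H R])
  also have "transpose_mat X * (X * W - Y) = transpose_mat X * (X * W) - transpose_mat X * Y"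
    by (rule mult_minus_distrib_mat[OF XT XW Y])
  also have "frobenius_inner H \<dots> =
      frobenius_inner H (transpose_mat X * (X * W)) - frobenius_inner H (transpose_mat X * Y)"
    using XT XW Y by (intro frobenius_inner_diff_right[OF H]) auto
  finally have cross: "frobenius_inner (X * H) (X * W - Y) = \<dots>" .
  have "frobenius_inner (X * H) (X * H) = frobenius_inner H (transpose_mat X * (X * H))"
    by (rule frobenius_inner_mult_left[OF X H XH])
  with cross show ?thesis
    unfolding frobenius_norm_sq eq frobenius_inner_add_self[OF R XH]
    by (simp add: assoc_mult_mat[OF XT X W] assoc_mult_mat[OF XT X H])
qed

section \<open>Weighted ridge regression\<close>

text \<open>The weighted loss for an abstract family of design blocks \<open>X i\<close> and target
  blocks \<open>Y i\<close>. Its gradient at \<open>W\<close> is twice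
  \<open>ridge_gram * W - ridge_rhs\<close>, so the two matrices defined next are the sides of the
  normal equation.\<close>

definition ridge_loss ::
    "'i set \<Rightarrow> ('i \<Rightarrow> real) \<Rightarrow> real \<Rightarrow> ('i \<Rightarrow> real mat) \<Rightarrow> ('i \<Rightarrow> real mat) \<Rightarrow> real mat \<Rightarrow> real" where
  "ridge_loss I w \<gamma> X Y W =
     (\<Sum>i\<in>I. w i * (frobenius_norm (X i * W - Y i))\<^sup>2) + \<gamma> * (frobenius_norm W)\<^sup>2"

definition ridge_gram ::
    "nat \<Rightarrow> 'i set \<Rightarrow> ('i \<Rightarrow> real) \<Rightarrow> real \<Rightarrow> ('i \<Rightarrow> real mat) \<Rightarrow> real mat" where
  "ridge_gram f I w \<gamma> X =
     mat_finsum f f (\<lambda>i. w i \<cdot>\<^sub>m (transpose_mat (X i) * X i)) I + \<gamma> \<cdot>\<^sub>m 1\<^sub>m f"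

definition ridge_rhs ::
    "nat \<Rightarrow> nat \<Rightarrow> 'i set \<Rightarrow> ('i \<Rightarrow> real) \<Rightarrow> ('i \<Rightarrow> real mat) \<Rightarrow> ('i \<Rightarrow> real mat) \<Rightarrow> real mat" where
  "ridge_rhs f m I w X Y = mat_finsum f m (\<lambda>i. w i \<cdot>\<^sub>m (transpose_mat (X i) * Y i)) I"

context
  fixes f m :: nat and I :: "'i set" and w :: "'i \<Rightarrow> real" and \<gamma> :: real
    and X Y :: "'i \<Rightarrow> real mat" and n :: "'i \<Rightarrow> nat"
  assumes fin: "finite I"
    and X: "\<And>i. i \<in> I \<Longrightarrow> X i \<in> carrier_mat (n i) f"
    and Y: "\<And>i. i \<in> I \<Longrightarrow> Y i \<in> carrier_mat (n i) m"
begin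

lemma gram_summand_carrier: "i \<in> I \<Longrightarrow> w i \<cdot>\<^sub>m (transpose_mat (X i) * X i) \<in> carrier_mat f f"
  using X by fastforce

lemma rhs_summand_carrier: "i \<in> I \<Longrightarrow> w i \<cdot>\<^sub>m (transpose_mat (X i) * Y i) \<in> carrier_mat f m"
  using X Y by fastforce

lemma ridge_gram_carrier: "ridge_gram f I w \<gamma> X \<in> carrier_mat f f"
  \<comment> \<open>A sum of matrices takes its dimensions from the second summand, here the
    multiple of the identity.\<close>
  unfolding ridge_gram_def by (intro add_carrier_mat smult_carrier_mat one_carrier_mat)

lemma ridge_rhs_carrier: "ridge_rhs f m I w X Y \<in> carrier_mat f m"
  unfolding ridge_rhs_def by (intro mat_finsum_closed rhs_summand_carrier)

lemma frobenius_inner_ridge_rhs: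
  assumes H: "H \<in> carrier_mat f m"
  shows "frobenius_inner H (ridge_rhs f m I w X Y) =
    (\<Sum>i\<in>I. w i * frobenius_inner H (transpose_mat (X i) * Y i))"
proof -
  have "frobenius_inner H (w i \<cdot>\<^sub>m (transpose_mat (X i) * Y i)) =
      w i * frobenius_inner H (transpose_mat (X i) * Y i)" if "i \<in> I" for i
    using X[OF that] Y[OF that] by (intro frobenius_inner_smult_right[OF H]) auto
  then show ?thesis
    unfolding ridge_rhs_def
    by (subst frobenius_inner_mat_finsum[OF fin H rhs_summand_carrier]) auto
qed

text \<open>The number \<open>p\<close> of columns stays free because two values occur:
  \<open>m\<close> in the expansion of the loss, and 1 when the Gram matrix acts on a single vector
  in the proof of invertibility.\<close>

lemma frobenius_inner_ridge_gram:
  assumes H: "H \<in> carrier_mat f p" and W: "W \<in> carrier_mat f p"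
  shows "frobenius_inner H (ridge_gram f I w \<gamma> X * W) =
    (\<Sum>i\<in>I. w i * frobenius_inner H (transpose_mat (X i) * X i * W)) + \<gamma> * frobenius_inner H W"
proof -
  let ?S = "mat_finsum f f (\<lambda>i. w i \<cdot>\<^sub>m (transpose_mat (X i) * X i)) I"
  have S: "?S \<in> carrier_mat f f" by (intro mat_finsum_closed gram_summand_carrier)
  have summand: "frobenius_inner H (w i \<cdot>\<^sub>m (transpose_mat (X i) * X i) * W) =
      w i * frobenius_inner H (transpose_mat (X i) * X i * W)" if "i \<in> I" for i
  proof -
    have G: "transpose_mat (X i) * X i \<in> carrier_mat f f" using X[OF that] by auto
    then have "transpose_mat (X i) * X i * W \<in> carrier_mat f p" using W by auto
    then show ?thesis
      unfolding mult_smult_assoc_mat[OF G W] by (rule frobenius_inner_smult_right[OF H])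
  qed
  have "(?S + \<gamma> \<cdot>\<^sub>m 1\<^sub>m f) * W = ?S * W + \<gamma> \<cdot>\<^sub>m 1\<^sub>m f * W"
    using S W by (intro add_mult_distrib_mat) auto
  also have "\<gamma> \<cdot>\<^sub>m 1\<^sub>m f * W = \<gamma> \<cdot>\<^sub>m W"
    using mult_smult_assoc_mat[OF one_carrier_mat W] W by simp
  finally have "frobenius_inner H (ridge_gram f I w \<gamma> X * W) =
      frobenius_inner H (?S * W) + \<gamma> * frobenius_inner H W"
    unfolding ridge_gram_def using S W
    by (simp add: frobenius_inner_add_right[OF H] frobenius_inner_smult_right[OF H])
  also have "frobenius_inner H (?S * W) =
      (\<Sum>i\<in>I. frobenius_inner H (w i \<cdot>\<^sub>m (transpose_mat (X i) * X i) * W))"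
    using gram_summand_carrier by (rule frobenius_inner_mat_finsum_mult[OF fin H W])
  finally show ?thesis using summand by simp
qed

lemma ridge_loss_add:
  assumes W: "W \<in> carrier_mat f m" and H: "H \<in> carrier_mat f m"
  shows "ridge_loss I w \<gamma> X Y (W + H) = ridge_loss I w \<gamma> X Y W
    + 2 * frobenius_inner H (ridge_gram f I w \<gamma> X * W - ridge_rhs f m I w X Y)
    + frobenius_inner H (ridge_gram f I w \<gamma> X * H)"
proof -
  have GW: "ridge_gram f I w \<gamma> X * W \<in> carrier_mat f m" using ridge_gram_carrier W by simp
  have "(\<Sum>i\<in>I. w i * (frobenius_norm (X i * (W + H) - Y i))\<^sup>2) =
      (\<Sum>i\<in>I. w i * (frobenius_norm (X i * W - Y i))\<^sup>2)
      + 2 * ((\<Sum>i\<in>I. w i * frobenius_inner H (transpose_mat (X i) * X i * W))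
        - (\<Sum>i\<in>I. w i * frobenius_inner H (transpose_mat (X i) * Y i)))
      + (\<Sum>i\<in>I. w i * frobenius_inner H (transpose_mat (X i) * X i * H))"
    \<comment> \<open>Everything is merged into one sum over \<open>I\<close>, so that the identity
      is checked summand by summand.\<close>
    unfolding sum_distrib_left sum.distrib[symmetric] sum_subtractf[symmetric]
    by (rule sum.cong[OF refl])
      (simp add: frobenius_norm_residual_add[OF X Y W H] algebra_simps)
  then show ?thesis
    unfolding ridge_loss_def frobenius_inner_diff_right[OF H GW ridge_rhs_carrier]
      frobenius_inner_ridge_rhs[OF H] frobenius_inner_ridge_gram[OF H W]
      frobenius_inner_ridge_gram[OF H H]
    using frobenius_inner_add_self[OF W H]
    by (simp add: frobenius_norm_sq[of W] frobenius_norm_sq[of "W + H"] algebra_simps)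
qed

text \<open>By the adjoint law each summand is \<open>w i\<close> times the squared norm of
  \<open>X i * H\<close>, hence nonnegative; strictness comes from \<gamma> times the squared norm
  of \<open>H\<close>.\<close>

lemma ridge_gram_pos:
  assumes \<gamma>: "0 < \<gamma>" and w: "\<And>i. i \<in> I \<Longrightarrow> 0 \<le> w i"
    and H: "H \<in> carrier_mat f p" "H \<noteq> 0\<^sub>m f p"
  shows "0 < frobenius_inner H (ridge_gram f I w \<gamma> X * H)"
proof -
  have "0 \<le> w i * frobenius_inner H (transpose_mat (X i) * X i * H)" if "i \<in> I" for i
  proof -
    have Xi: "X i \<in> carrier_mat (n i) f" using X that .
    then have "frobenius_inner (X i * H) (X i * H) =
        frobenius_inner H (transpose_mat (X i) * (X i * H))"
      using H by (intro frobenius_inner_mult_left) auto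
    also have "transpose_mat (X i) * (X i * H) = transpose_mat (X i) * X i * H"
      using Xi H by (intro assoc_mult_mat[symmetric]) auto
    finally show ?thesis using w[OF that] frobenius_inner_self_nonneg[of "X i * H"] by simp
  qed
  then have "0 \<le> (\<Sum>i\<in>I. w i * frobenius_inner H (transpose_mat (X i) * X i * H))"
    by (rule sum_nonneg)
  moreover have "0 < \<gamma> * frobenius_inner H H" using frobenius_inner_self_pos[OF H] \<gamma> by simp
  ultimately show ?thesis unfolding frobenius_inner_ridge_gram[OF H(1) H(1)] by simp
qed

text \<open>A singular matrix annihilates some nonzero vector. Written as a one-column matrix, that
  vector makes the quadratic form vanish, against \<open>ridge_gram_pos\<close>.\<close>

lemma ridge_gram_invertible:
  assumes "0 < \<gamma>" "\<And>i. i \<in> I \<Longrightarrow> 0 \<le> w i"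
  shows "invertible_mat (ridge_gram f I w \<gamma> X)"
proof -
  let ?M = "ridge_gram f I w \<gamma> X"
  note M = ridge_gram_carrier
  have "det ?M \<noteq> 0"
  proof
    assume "det ?M = 0"
    then obtain v where v: "v \<in> carrier_vec f" "v \<noteq> 0\<^sub>v f" "?M *\<^sub>v v = 0\<^sub>v f"
      using det_0_iff_vec_prod_zero[OF M] by blast
    let ?H = "mat_of_cols f [v]"
    have H: "?H \<in> carrier_mat f 1" using mat_of_cols_carrier(1)[of f "[v]"] by simp
    have col: "col ?H 0 = v" using v by simp
    have "?H \<noteq> 0\<^sub>m f 1"
    proof
      assume "?H = 0\<^sub>m f 1"
      with col v(2) show False by simp
    qed
    then have "0 < frobenius_inner ?H (?M * ?H)" using ridge_gram_pos[OF assms H] by simp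
    moreover have "?M * ?H = 0\<^sub>m f 1"
    proof (rule eq_matI)
      fix i j assume ij: "i < dim_row (0\<^sub>m f 1 :: real mat)" "j < dim_col (0\<^sub>m f 1 :: real mat)"
      then have "(?M * ?H) $$ (i, j) = (?M *\<^sub>v v) $ i" using M H col by simp
      then show "(?M * ?H) $$ (i, j) = 0\<^sub>m f 1 $$ (i, j)" using v(3) ij by simp
    qed (use M H in auto)
    ultimately show False using frobenius_inner_zero_right[OF H] by simp
  qed
  \<comment> \<open>\<open>()\<close> fills the extension slot of the ring record
    \<open>ring_mat\<close>, whose units are the matrices with a two-sided inverse.\<close>
  from det_non_zero_imp_unit[OF M this, of "()"] obtain B where
    "B \<in> carrier_mat f f" "?M * B = 1\<^sub>m f" "B * ?M = 1\<^sub>m f"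
    unfolding Units_def by (auto simp: ring_mat_def)
  then show ?thesis using M unfolding invertible_mat_def inverts_mat_def by auto
qed

text \<open>First-order condition along the line \<open>W + s G\<close>, where \<open>G\<close> is
  half the gradient. Minimality gives \<open>2 s a + s^2 b >= 0\<close> for every real
  \<open>s\<close>, with \<open>a\<close> the squared norm of \<open>G\<close>; this forces
  \<open>a = 0\<close>. The argument covers weights and \<gamma> of either sign.\<close>

lemma ridge_normal_equation_if_minimal:
  assumes min: "is_arg_min (ridge_loss I w \<gamma> X Y) (\<lambda>W. W \<in> carrier_mat f m) W"
  shows "ridge_gram f I w \<gamma> X * W = ridge_rhs f m I w X Y"
proof -
  let ?M = "ridge_gram f I w \<gamma> X" and ?B = "ridge_rhs f m I w X Y"
  define G where "G = ?M * W - ?B"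
  note M = ridge_gram_carrier and B = ridge_rhs_carrier
  have W: "W \<in> carrier_mat f m" using min by (simp add: is_arg_min_def)
  have G: "G \<in> carrier_mat f m" unfolding G_def using B by auto
  have MG: "?M * G \<in> carrier_mat f m" using M G by auto
  define a where "a = frobenius_inner G G"
  define b where "b = frobenius_inner G (?M * G)"
  have nonneg: "0 \<le> 2 * (s * a) + s * (s * b)" for s
  proof -
    have sG: "s \<cdot>\<^sub>m G \<in> carrier_mat f m" using G by simp
    then have "\<not> ridge_loss I w \<gamma> X Y (W + s \<cdot>\<^sub>m G) < ridge_loss I w \<gamma> X Y W"
      using min by (auto simp: is_arg_min_def)
    moreover have "ridge_loss I w \<gamma> X Y (W + s \<cdot>\<^sub>m G) =
        ridge_loss I w \<gamma> X Y W + 2 * (s * a) + s * (s * b)"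
      unfolding ridge_loss_add[OF W sG] mult_smult_distrib[OF M G] G_def[symmetric]
      using frobenius_inner_smult_left[OF G] frobenius_inner_smult_right[OF G MG]
      by (simp add: a_def b_def)
    ultimately show ?thesis by linarith
  qed
  have "a = 0"
  proof (rule ccontr)
    assume "a \<noteq> 0"
    then have a: "0 < a" using frobenius_inner_self_nonneg[of G] by (simp add: a_def)
    \<comment> \<open>A step this short makes the linear term dominate, whatever the sign of \<open>b\<close>.\<close>
    define s where "s = - a / (\<bar>b\<bar> + 1)"
    have "\<bar>s * b\<bar> \<le> a"
      using a by (simp add: s_def abs_mult divide_simps)
    moreover have "s < 0" using a by (simp add: s_def divide_neg_pos)
    \<comment> \<open>The second factor is at least \<open>a\<close>, hence positive.\<close>
    ultimately have "s * (2 * a + s * b) < 0" using a by (intro mult_neg_pos) auto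
    then show False using nonneg[of s] by (simp add: algebra_simps)
  qed
  then have "G = 0\<^sub>m f m" unfolding a_def by (rule frobenius_inner_self_eq_0[OF G])
  then have "(?M * W - ?B) + ?B = ?B" using B by (simp add: G_def)
  moreover have "(?M * W - ?B) + ?B = ?M * W"
    using M W B by (intro diff_add_mat_cancel) auto
  ultimately show ?thesis by simp
qed

text \<open>With \<open>H = V - W\<close> in \<open>ridge_loss_add\<close>, the normal equation
  removes the linear term and \<open>ridge_gram_pos\<close> makes the remaining excess
  positive.\<close>

lemma ridge_strict_minimum:
  assumes \<gamma>: "0 < \<gamma>" and w: "\<And>i. i \<in> I \<Longrightarrow> 0 \<le> w i"
    and W: "W \<in> carrier_mat f m" "ridge_gram f I w \<gamma> X * W = ridge_rhs f m I w X Y"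
    and V: "V \<in> carrier_mat f m" "V \<noteq> W"
  shows "ridge_loss I w \<gamma> X Y W < ridge_loss I w \<gamma> X Y V"
proof -
  have H: "V - W \<in> carrier_mat f m" using W by auto
  have V_eq: "W + (V - W) = V" using V W by (intro eq_matI) auto
  have "V - W \<noteq> 0\<^sub>m f m"
  proof
    assume "V - W = 0\<^sub>m f m"
    with V_eq W V(2) show False by simp
  qed
  then have "0 < frobenius_inner (V - W) (ridge_gram f I w \<gamma> X * (V - W))"
    using ridge_gram_pos[OF \<gamma> w H] by blast
  moreover have "frobenius_inner (V - W) (ridge_gram f I w \<gamma> X * W - ridge_rhs f m I w X Y) = 0"
    using W(2) frobenius_inner_zero_right[OF H] ridge_rhs_carrier by simp
  ultimately show ?thesis using ridge_loss_add[OF W(1) H] V_eq by simp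
qed

end

section \<open>Inverses and linear matrix equations\<close>

text \<open>\<open>mat_inverse\<close> answers \<open>None\<close> on matrices that are not units,
  so \<open>the\<close> is meaningful only once \<open>M\<close> is known to be a unit of the matrix
  ring.\<close>

lemma the_mat_inverse:
  fixes M :: "real mat"
  assumes M: "M \<in> carrier_mat n n" and inv: "invertible_mat M"
  shows "the (mat_inverse M) \<in> carrier_mat n n"
    and "M * the (mat_inverse M) = 1\<^sub>m n" and "the (mat_inverse M) * M = 1\<^sub>m n"
proof -
  obtain B where MB: "M * B = 1\<^sub>m n" and BM: "B * M = 1\<^sub>m (dim_row B)"
    using inv M unfolding invertible_mat_def inverts_mat_def by auto
  \<comment> \<open>\<open>invertible_mat\<close> does not state the shape of \<open>B\<close>;
    comparing column counts in \<open>B * M\<close> and \<open>M * B\<close> recovers both of its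
    dimensions.\<close>
  have row: "dim_row B = n" using arg_cong[OF BM, of dim_col] M by simp
  moreover have "dim_col B = n" using arg_cong[OF MB, of dim_col] by simp
  ultimately have "B \<in> carrier_mat n n" by (rule carrier_matI)
  then have "M \<in> Units (ring_mat TYPE(real) n ())"
    unfolding Units_def ring_mat_simps using M MB BM row by auto
  then obtain N where N: "mat_inverse M = Some N"
    using mat_inverse(1)[OF M, of "()"] by (cases "mat_inverse M") auto
  from mat_inverse(2)[OF M N] N show "the (mat_inverse M) \<in> carrier_mat n n"
    "M * the (mat_inverse M) = 1\<^sub>m n" "the (mat_inverse M) * M = 1\<^sub>m n" by auto
qed

lemma mat_linear_solution_iff:
  fixes M :: "real mat"
  assumes M: "M \<in> carrier_mat n n" "invertible_mat M"
    and B: "B \<in> carrier_mat n m" and W: "W \<in> carrier_mat n m"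
  shows "M * W = B \<longleftrightarrow> W = the (mat_inverse M) * B"
proof
  note N = the_mat_inverse[OF M]
  assume "M * W = B"
  then show "W = the (mat_inverse M) * B"
    using assoc_mult_mat[OF N(1) M(1) W] N(3) W by simp
next
  note N = the_mat_inverse[OF M]
  assume "W = the (mat_inverse M) * B"
  then show "M * W = B"
    using assoc_mult_mat[OF M(1) N(1) B] N(2) B by simp
qed

section \<open>Correlation matrices of stacked samples\<close>

text \<open>Each entry of such a product is a sum over rows, that is, over samples, so appending
  samples splits the sum. The length assumptions keep features and labels aligned across the
  split.\<close>

lemma transpose_mat_of_rows_append_mult:
  assumes "length us = length vs" and "length us' = length vs'"
  shows "transpose_mat (mat_of_rows n (us @ us')) * mat_of_rows m (vs @ vs') =
    transpose_mat (mat_of_rows n us) * mat_of_rows m vs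
    + transpose_mat (mat_of_rows n us') * (mat_of_rows m vs' :: real mat)"
proof (rule eq_matI)
  let ?lhs = "transpose_mat (mat_of_rows n (us @ us')) * mat_of_rows m (vs @ vs')"
  let ?rhs = "transpose_mat (mat_of_rows n us) * mat_of_rows m vs
    + transpose_mat (mat_of_rows n us') * mat_of_rows m vs'"
  fix i j assume "i < dim_row ?rhs" "j < dim_col ?rhs"
  then have ij: "i < n" "j < m" by auto
  let ?g = "\<lambda>r. (us @ us') ! r $ i * (vs @ vs') ! r $ j"
  have split: "(\<Sum>r<a + b. g r) = (\<Sum>r<a. g r) + (\<Sum>r<b. g (a + r))"
    for a b and g :: "nat \<Rightarrow> real"
    by (induction b) simp_all
  have "?lhs $$ (i, j) = (\<Sum>r<length vs + length vs'. ?g r)"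
    using ij assms by (simp add: scalar_prod_def mat_of_rows_def lessThan_atLeast0)
  also have "\<dots> = (\<Sum>r<length vs. ?g r) + (\<Sum>r<length vs'. ?g (length vs + r))"
    by (rule split)
  also have "\<dots> = ?rhs $$ (i, j)"
    using ij assms
    by (simp add: scalar_prod_def mat_of_rows_def lessThan_atLeast0 nth_append)
  finally show "?lhs $$ (i, j) = ?rhs $$ (i, j)" .
qed auto

text \<open>Stacking amounts to concatenating sample lists, because \<open>rows\<close> undoes
  \<open>mat_of_rows\<close> on vectors of length \<open>f\<close>. For the labels the length is
  guaranteed by \<open>unit_vec\<close>.\<close>

lemma features_upto_eq:
  assumes "\<forall>t\<in>{1..k}. \<forall>s\<in>set (D t). fst s \<in> carrier_vec f"
  shows "features_upto f D k y =
    mat_of_rows f (map fst (concat (map (\<lambda>t. class_samples D t y) [1..<Suc k])))"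
proof -
  have "map (\<lambda>t. rows (feature_mat f D t y)) [1..<Suc k] =
      map (\<lambda>t. map fst (class_samples D t y)) [1..<Suc k]"
    unfolding feature_mat_def using assms
    by (intro map_cong refl rows_mat_of_rows) (auto simp: class_samples_def)
  then show ?thesis
    unfolding features_upto_def vstack_def map_concat map_map comp_def by (simp only:)
qed

lemma labels_upto_eq:
  "labels_upto m D k y = mat_of_rows m
    (map (\<lambda>s. unit_vec m (snd s)) (concat (map (\<lambda>t. class_samples D t y) [1..<Suc k])))"
proof -
  have "map (\<lambda>t. rows (label_mat m D t y)) [1..<Suc k] =
      map (\<lambda>t. map (\<lambda>s. unit_vec m (snd s)) (class_samples D t y)) [1..<Suc k]"
    unfolding label_mat_def by (intro map_cong refl rows_mat_of_rows) auto
  then show ?thesis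
    unfolding labels_upto_def vstack_def map_concat map_map comp_def by (simp only:)
qed

text \<open>The row count is expressed through the sample list so that features and labels of a
  class share literally the same count, as the ridge regression results require.\<close>

lemma features_upto_carrier:
  assumes "\<forall>t\<in>{1..k}. \<forall>s\<in>set (D t). fst s \<in> carrier_vec f"
  shows "features_upto f D k y \<in>
    carrier_mat (length (concat (map (\<lambda>t. class_samples D t y) [1..<Suc k]))) f"
  unfolding features_upto_eq[OF assms] by (intro carrier_matI) simp_all

lemma labels_upto_carrier:
  "labels_upto m D k y \<in>
    carrier_mat (length (concat (map (\<lambda>t. class_samples D t y) [1..<Suc k]))) m"
  unfolding labels_upto_eq by (intro carrier_matI) simp_all

section \<open>Phasewise accumulation of the correlation matrices\<close>

lemma correlation_carriers:
  "transpose_mat (feature_mat f D t y) * feature_mat f D t y \<in> carrier_mat f f"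
  "transpose_mat (feature_mat f D t y) * label_mat m D t y \<in> carrier_mat f m"
  by (intro carrier_matI; simp add: feature_mat_def label_mat_def)+

text \<open>Insertion puts the new summand first; commutativity moves it last, where the phase
  recursion has it.\<close>

lemma mat_finsum_atLeast1_Suc:
  assumes "\<And>t. F t \<in> carrier_mat n m"
  shows "mat_finsum n m F {1..Suc k} = mat_finsum n m F {1..k} + F (Suc k)"
proof -
  have "mat_finsum n m F {1..Suc k} = F (Suc k) + mat_finsum n m F {1..k}"
    using assms mat_finsum_insert[of "{1..k}" "Suc k" F n m]
    by (simp add: atLeastAtMostSuc_conv)
  then show ?thesis
    using comm_add_mat[OF assms[of "Suc k"] mat_finsum_closed[of "{1..k}" F n m]] assms by simp
qed

lemma correlation_0:
  "autocorrelation f D 0 y = 0\<^sub>m f f" "crosscorrelation f m D 0 y = 0\<^sub>m f m"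
  by (simp_all add: autocorrelation_def crosscorrelation_def mat_finsum_empty)

lemma correlation_Suc:
  "autocorrelation f D (Suc k) y = autocorrelation f D k y
     + transpose_mat (feature_mat f D (Suc k) y) * feature_mat f D (Suc k) y"
  "crosscorrelation f m D (Suc k) y = crosscorrelation f m D k y
     + transpose_mat (feature_mat f D (Suc k) y) * label_mat m D (Suc k) y"
  unfolding autocorrelation_def crosscorrelation_def
  by (intro mat_finsum_atLeast1_Suc correlation_carriers)+

text \<open>Links the iteratively computed matrix to the Gram matrix of the stacked features, the
  one occurring in the normal equation. The induction step appends the rows of one more
  phase.\<close>

lemma autocorrelation_eq:
  assumes "\<forall>t\<in>{1..k}. \<forall>s\<in>set (D t). fst s \<in> carrier_vec f"
  shows "autocorrelation f D k y = transpose_mat (features_upto f D k y) * features_upto f D k y"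
  using assms
proof (induction k)
  case 0
  show ?case
    \<comment> \<open>Without phases the stacked matrix has no rows, and every entry of its Gram
      matrix is an empty sum.\<close>
    unfolding features_upto_eq[OF "0.prems"] correlation_0
    by (intro eq_matI) (auto simp: scalar_prod_def)
next
  case (Suc k)
  then have "\<forall>t\<in>{1..k}. \<forall>s\<in>set (D t). fst s \<in> carrier_vec f" by auto
  with Suc.IH show ?case
    unfolding features_upto_eq[OF Suc.prems]
    by (simp add: correlation_Suc features_upto_eq transpose_mat_of_rows_append_mult
        feature_mat_def)
qed

lemma crosscorrelation_eq:
  assumes "\<forall>t\<in>{1..k}. \<forall>s\<in>set (D t). fst s \<in> carrier_vec f"
  shows "crosscorrelation f m D k y =
    transpose_mat (features_upto f D k y) * labels_upto m D k y"
  using assms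
proof (induction k)
  case 0
  show ?case
    unfolding features_upto_eq[OF "0.prems"] labels_upto_eq correlation_0
    by (intro eq_matI) (auto simp: scalar_prod_def)
next
  case (Suc k)
  then have "\<forall>t\<in>{1..k}. \<forall>s\<in>set (D t). fst s \<in> carrier_vec f" by auto
  with Suc.IH show ?case
    unfolding features_upto_eq[OF Suc.prems]
    by (simp add: correlation_Suc features_upto_eq labels_upto_eq
        transpose_mat_of_rows_append_mult feature_mat_def label_mat_def)
qed

text \<open>For arbitrary weights the loss can be unbounded below, so existence of a minimiser is
  derived for positive \<gamma> and nonnegative weights; otherwise the closed form is asserted when
  \<open>M\<close> is invertible and a minimiser exists. A nonempty phase makes
  \<open>max_label\<close> the maximum of a nonempty set.\<close>

theorem theorem1:
  fixes f k :: nat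
    and D :: "nat \<Rightarrow> sample list"
    and w :: "nat \<Rightarrow> real"
    and \<gamma> :: real
  assumes "1 \<le> k"
    and "\<exists>t\<in>{1..k}. D t \<noteq> []"
    and "\<forall>t\<in>{1..k}. \<forall>s\<in>set (D t). fst s \<in> carrier_vec f"
  shows
    "let C = max_label D k;
         m = C + 1;
         M = mat_finsum f f (\<lambda>y. w y \<cdot>\<^sub>m autocorrelation f D k y) {0..C} + \<gamma> \<cdot>\<^sub>m 1\<^sub>m f;
         B = mat_finsum f m (\<lambda>y. w y \<cdot>\<^sub>m crosscorrelation f m D k y) {0..C};
         argmins = {W. is_arg_min (weighted_loss f D k w \<gamma>) (\<lambda>W. W \<in> carrier_mat f m) W}
     in (0 < \<gamma> \<and> (\<forall>y\<le>C. 0 \<le> w y) \<longrightarrow>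
           invertible_mat M \<and> argmins = {the (mat_inverse M) * B})
      \<and> (invertible_mat M \<and> argmins \<noteq> {} \<longrightarrow> argmins = {the (mat_inverse M) * B})
      \<and> (\<forall>y\<le>C. autocorrelation f D 0 y = 0\<^sub>m f f \<and> crosscorrelation f m D 0 y = 0\<^sub>m f m
           \<and> (\<forall>j\<in>{1..k}.
                autocorrelation f D j y = autocorrelation f D (j - 1) y
                  + transpose_mat (feature_mat f D j y) * feature_mat f D j y
              \<and> crosscorrelation f m D j y = crosscorrelation f m D (j - 1) y
                  + transpose_mat (feature_mat f D j y) * label_mat m D j y))"
proof -
  define C where "C = max_label D k"
  define m where "m = C + 1"
  let ?X = "features_upto f D k" and ?Y = "labels_upto m D k"
  define M where "M = ridge_gram f {0..C} w \<gamma> ?X"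
  define B where "B = ridge_rhs f m {0..C} w ?X ?Y"
  define argmins where
    "argmins = {W. is_arg_min (weighted_loss f D k w \<gamma>) (\<lambda>W. W \<in> carrier_mat f m) W}"
  note fin = finite_atLeastAtMost[of 0 C]
  note X = features_upto_carrier[OF assms(3)] and Y = labels_upto_carrier[of m D k]
  have M_eq: "mat_finsum f f (\<lambda>y. w y \<cdot>\<^sub>m autocorrelation f D k y) {0..C} + \<gamma> \<cdot>\<^sub>m 1\<^sub>m f = M"
    unfolding M_def ridge_gram_def autocorrelation_eq[OF assms(3)] ..
  have B_eq: "mat_finsum f m (\<lambda>y. w y \<cdot>\<^sub>m crosscorrelation f m D k y) {0..C} = B"
    unfolding B_def ridge_rhs_def crosscorrelation_eq[OF assms(3)] ..
  have loss_eq: "weighted_loss f D k w \<gamma> = ridge_loss {0..C} w \<gamma> ?X ?Y"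
    by (simp add: fun_eq_iff weighted_loss_def ridge_loss_def C_def m_def atLeast0AtMost)
  have M: "M \<in> carrier_mat f f" unfolding M_def by (rule ridge_gram_carrier[OF fin X Y])
  have B: "B \<in> carrier_mat f m" unfolding B_def by (rule ridge_rhs_carrier[OF fin X Y])
  \<comment> \<open>Only an inclusion, since \<open>argmins\<close> may be empty here; with a
    minimiser at hand it becomes an equality.\<close>
  have sub: "argmins \<subseteq> {the (mat_inverse M) * B}" if "invertible_mat M"
  proof
    fix W assume "W \<in> argmins"
    then have min: "is_arg_min (ridge_loss {0..C} w \<gamma> ?X ?Y) (\<lambda>W. W \<in> carrier_mat f m) W"
      by (simp add: argmins_def loss_eq)
    then have "M * W = B"
      unfolding M_def B_def by (rule ridge_normal_equation_if_minimal[OF fin X Y])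
    moreover have "W \<in> carrier_mat f m" using min by (simp add: is_arg_min_def)
    ultimately show "W \<in> {the (mat_inverse M) * B}"
      using mat_linear_solution_iff[OF M that B] by simp
  qed
  have convex: "invertible_mat M \<and> argmins = {the (mat_inverse M) * B}"
    if \<gamma>: "0 < \<gamma>" and w: "\<forall>y\<le>C. 0 \<le> w y"
  proof -
    have w': "0 \<le> w y" if "y \<in> {0..C}" for y using w that by simp
    have inv: "invertible_mat M"
      unfolding M_def by (rule ridge_gram_invertible[OF fin X Y \<gamma> w'])
    let ?W = "the (mat_inverse M) * B"
    have W: "?W \<in> carrier_mat f m" using the_mat_inverse(1)[OF M inv] B by simp
    then have "M * ?W = B" using mat_linear_solution_iff[OF M inv B] by simp
    then have "ridge_loss {0..C} w \<gamma> ?X ?Y ?W < ridge_loss {0..C} w \<gamma> ?X ?Y V"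
      if "V \<in> carrier_mat f m" "V \<noteq> ?W" for V
      unfolding M_def B_def
      using ridge_strict_minimum[OF fin X Y \<gamma> w' W[unfolded M_def B_def]] that
      by (simp add: M_def B_def)
    \<comment> \<open>Existence comes from the strict inequality, uniqueness from
      \<open>sub\<close>.\<close>
    then have "?W \<in> argmins"
      using W unfolding argmins_def loss_eq is_arg_min_def by (auto dest: less_asym)
    then show ?thesis using sub[OF inv] inv by auto
  qed
  \<comment> \<open>As \<open>j\<close> is at least 1, truncated subtraction is harmless:
    \<open>Suc (j - 1) = j\<close>.\<close>
  have "autocorrelation f D j y = autocorrelation f D (j - 1) y
      + transpose_mat (feature_mat f D j y) * feature_mat f D j y
    \<and> crosscorrelation f m D j y = crosscorrelation f m D (j - 1) y
      + transpose_mat (feature_mat f D j y) * label_mat m D j y" if "j \<in> {1..k}" for j y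
    using that correlation_Suc[where k = "j - 1"] by simp
  then show ?thesis
    unfolding Let_def C_def[symmetric] m_def[symmetric] M_eq B_eq argmins_def[symmetric]
    using convex sub correlation_0 by blast
qed

end
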